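(* Let $G$ be a connected graph with vertex set $\{1,\dots,n\}$, $n\ge 2$, let $\Phi=(F_1,\dots,F_n)$ be an $n$-tuple of pairwise disjoint graphs, and let $G[\Phi]$ be the generalized lexicographic product. Then $\gamma(G)\le\gamma(G[\Phi])$. Equality holds if and only if there is a minimum dominating set $I$ of $G$ such that for every vertex $j\in I$ which is an isolated vertex of the induced subgraph $\langle I\rangle$ we have $\gamma(F_j)=1$. Moreover, if $\gamma(G)=\gamma(G[\Phi])$, then $|D\cap V(F_i)|\le 1$ for all $i=1,\dots,n$ and every minimum dominating set $D$ of $G[\Phi]$.
   Context: All graphs are finite, simple and undirected. The generalized lexicographic product $G[\Phi]$ is the graph with vertex set $\bigcup_{i=1}^n V(F_i)$ in which each $F_i$ is an induced subgraph, and for $x\in V(F_i)$, $y\in V(F_j)$ with $i\neq j$, $xy$ is an edge iff $ij\in E(G)$. A dominating set of a graph $H$ is a set $D\subseteq V(H)$ such that every vertex not in $D$ has a neighbor in $D$; $\gamma(H)$ is the minimum cardinality of a dominating set. *)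

theory Defs
  imports "Graph_Theory.Graph_Theory" "HOL-Library.Disjoint_Sets"
begin

text \<open>
  A finite simple undirected graph is a \<^locale>\<open>pair_graph\<close>: a finite, loop-free, symmetric
  digraph whose arcs are pairs of vertices; an undirected edge is a pair of opposite arcs.
  The notions below are meant for such graphs, where the direction of an arc is immaterial.
\<close>

definition dominating_set :: "('a, 'b) pre_digraph \<Rightarrow> 'a set \<Rightarrow> bool" where
  "dominating_set H D \<longleftrightarrow>
     D \<subseteq> verts H \<and> (\<forall>v \<in> verts H - D. \<exists>u \<in> D. v \<rightarrow>\<^bsub>H\<^esub> u)"

definition domination_number :: "('a, 'b) pre_digraph \<Rightarrow> nat" where
  "domination_number H = Min (card ` {D. dominating_set H D})"

definition minimum_dominating_set :: "('a, 'b) pre_digraph \<Rightarrow> 'a set \<Rightarrow> bool" where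
  "minimum_dominating_set H D \<longleftrightarrow> dominating_set H D \<and> card D = domination_number H"

definition isolated_vertex :: "('a, 'b) pre_digraph \<Rightarrow> 'a \<Rightarrow> bool" where
  "isolated_vertex H v \<longleftrightarrow> v \<in> verts H \<and> \<not> (\<exists>u \<in> verts H. v \<rightarrow>\<^bsub>H\<^esub> u)"

definition gen_lex_product ::
  "'i pair_pre_digraph \<Rightarrow> ('i \<Rightarrow> 'a pair_pre_digraph) \<Rightarrow> 'a pair_pre_digraph" where
  "gen_lex_product G F =
     \<lparr> pverts = (\<Union>i \<in> pverts G. pverts (F i)),
       parcs = (\<Union>i \<in> pverts G. parcs (F i)) \<union>
         {(x, y). \<exists>i \<in> pverts G. \<exists>j \<in> pverts G.
            i \<noteq> j \<and> x \<in> pverts (F i) \<and> y \<in> pverts (F j) \<and> (i, j) \<in> parcs G} \<rparr>"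

lemma pair_graph_gen_lex_product:
  assumes G: "pair_graph G"
    and F: "\<And>i. i \<in> pverts G \<Longrightarrow> pair_graph (F i)"
    and disj: "disjoint_family_on (\<lambda>i. pverts (F i)) (pverts G)"
  shows "pair_graph (gen_lex_product G F)" (is "pair_graph ?P")
proof -
  interpret G: pair_graph G by (rule G)
  have ends: "x \<in> pverts (F i)" "y \<in> pverts (F i)" "x \<noteq> y" "(y, x) \<in> parcs (F i)"
    if "i \<in> pverts G" "(x, y) \<in> parcs (F i)" for i x y
  proof -
    interpret Fi: pair_graph "F i" by (rule F) (rule that)
    show "x \<in> pverts (F i)" "y \<in> pverts (F i)" "x \<noteq> y" "(y, x) \<in> parcs (F i)"
      using that(2) by (blast dest: Fi.in_arcsD1 Fi.in_arcsD2 Fi.no_loops' Fi.arcs_symmetric)+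
  qed
  have sub: "parcs ?P \<subseteq> pverts ?P \<times> pverts ?P"
    unfolding gen_lex_product_def using ends(1,2) by fastforce
  have fin: "finite (pverts ?P)"
    using G.pair_finite_verts F
    by (simp add: gen_lex_product_def pair_graph_def pair_digraph_def
        pair_fin_digraph_def pair_fin_digraph_axioms_def)
  have arcE: "(\<exists>i \<in> pverts G. (x, y) \<in> parcs (F i)) \<or>
      (\<exists>i \<in> pverts G. \<exists>j \<in> pverts G.
        i \<noteq> j \<and> x \<in> pverts (F i) \<and> y \<in> pverts (F j) \<and> (i, j) \<in> parcs G)"
    if "(x, y) \<in> parcs ?P" for x y
    using that by (simp add: gen_lex_product_def)
  have "(y, x) \<in> parcs ?P" if "(x, y) \<in> parcs ?P" for x y
    using arcE[OF that]
  proof (elim disjE bexE conjE)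
    fix i assume "i \<in> pverts G" "(x, y) \<in> parcs (F i)"
    then have "i \<in> pverts G" "(y, x) \<in> parcs (F i)" by (simp_all only: ends(4))
    then show ?thesis unfolding gen_lex_product_def by auto
  next
    fix i j assume *: "i \<in> pverts G" "j \<in> pverts G" "i \<noteq> j" "x \<in> pverts (F i)" "y \<in> pverts (F j)"
      and "(i, j) \<in> parcs G"
    then have "(j, i) \<in> parcs G" by (blast intro: G.arcs_symmetric)
    with * show ?thesis unfolding gen_lex_product_def by simp metis
  qed
  then have "symmetric (with_proj ?P)"
    by (simp add: symmetric_def sym_def)
  moreover have "x \<noteq> y" if "(x, y) \<in> parcs ?P" for x y
    using arcE[OF that]
  proof (elim disjE bexE conjE)
    fix i assume "i \<in> pverts G" "(x, y) \<in> parcs (F i)"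
    then show ?thesis by (rule ends(3))
  next
    fix i j assume "i \<in> pverts G" "j \<in> pverts G" "i \<noteq> j" "x \<in> pverts (F i)" "y \<in> pverts (F j)"
    then show ?thesis using disj by (auto simp: disjoint_family_on_def)
  qed
  moreover have "finite (parcs ?P)"
    by (rule finite_subset[OF sub]) (simp add: fin)
  ultimately show ?thesis
    using sub fin by unfold_locales auto
qed

lemma gen_lex_product_induced:
  assumes G: "pair_graph G"
    and F: "\<And>i. i \<in> pverts G \<Longrightarrow> pair_graph (F i)"
    and disj: "disjoint_family_on (\<lambda>i. pverts (F i)) (pverts G)"
    and i: "i \<in> pverts G"
  shows "induced_subgraph (with_proj (F i)) (with_proj (gen_lex_product G F))"
proof -
  interpret P: pair_graph "gen_lex_product G F"
    by (rule pair_graph_gen_lex_product[OF G F disj])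
  interpret Fi: pair_graph "F i" by (rule F) (rule i)
  have same: "k = i" if "k \<in> pverts G" "x \<in> pverts (F k)" "x \<in> pverts (F i)" for k x
    using disj i that by (auto simp: disjoint_family_on_def)
  have ends: "x \<in> pverts (F k)" if "k \<in> pverts G" "(x, y) \<in> parcs (F k)" for k x y
    using pair_wf_digraph.in_arcsD1 F that
    by (metis pair_graph_def pair_digraph_def pair_fin_digraph_def)
  have "(x, y) \<in> parcs (F i) \<longleftrightarrow>
      (x, y) \<in> parcs (gen_lex_product G F) \<and> x \<in> pverts (F i) \<and> y \<in> pverts (F i)" for x y
  proof
    assume "(x, y) \<in> parcs (F i)"
    then show "(x, y) \<in> parcs (gen_lex_product G F) \<and> x \<in> pverts (F i) \<and> y \<in> pverts (F i)"
      using i Fi.in_arcsD1 Fi.in_arcsD2 unfolding gen_lex_product_def by auto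
  next
    assume "(x, y) \<in> parcs (gen_lex_product G F) \<and> x \<in> pverts (F i) \<and> y \<in> pverts (F i)"
    then show "(x, y) \<in> parcs (F i)"
      unfolding gen_lex_product_def by simp (metis same ends)
  qed
  then have "parcs (F i) = {e \<in> parcs (gen_lex_product G F). fst e \<in> pverts (F i) \<and> snd e \<in> pverts (F i)}"
    by auto
  moreover from this have "parcs (F i) \<subseteq> parcs (gen_lex_product G F)"
    by (metis (no_types, lifting) mem_Collect_eq subsetI)
  moreover have "pverts (F i) \<subseteq> pverts (gen_lex_product G F)"
    using i unfolding gen_lex_product_def by auto
  ultimately show ?thesis
    using P.wf_digraph Fi.wf_digraph compatibleI_with_proj
    unfolding induced_subgraph_def subgraph_def with_proj_simps by metis
qed

lemma gen_lex_product_cross_arc: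
  assumes G: "pair_graph G"
    and F: "\<And>i. i \<in> pverts G \<Longrightarrow> pair_graph (F i)"
    and disj: "disjoint_family_on (\<lambda>i. pverts (F i)) (pverts G)"
    and "i \<in> pverts G" "j \<in> pverts G" "i \<noteq> j" "x \<in> pverts (F i)" "y \<in> pverts (F j)"
  shows "(x, y) \<in> parcs (gen_lex_product G F) \<longleftrightarrow> (i, j) \<in> parcs G"
proof -
  have same: "k = l" if "k \<in> pverts G" "l \<in> pverts G" "z \<in> pverts (F k)" "z \<in> pverts (F l)" for k l z
    using disj that by (auto simp: disjoint_family_on_def)
  have ends: "u \<in> pverts (F k) \<and> v \<in> pverts (F k)" if "k \<in> pverts G" "(u, v) \<in> parcs (F k)" for k u v
    using pair_wf_digraph.in_arcsD1 pair_wf_digraph.in_arcsD2 F that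
    by (metis pair_graph_def pair_digraph_def pair_fin_digraph_def)
  show ?thesis
    using assms(4-) unfolding gen_lex_product_def by simp (metis same ends)
qed

end

theory Submission
  imports Defs
begin

text \<open>
  If \<open>D\<close> dominates the product, the set \<open>J\<close> of all indices \<open>i\<close> such that \<open>D\<close> meets \<open>F\<^sub>i\<close> dominates
  \<open>G\<close>, and \<open>card J \<le> card D\<close>. If the domination numbers agree, this inequality is tight for a minimum
  \<open>D\<close>, so \<open>D\<close> is a transversal of the \<open>F\<^sub>j\<close> with \<open>j \<in> J\<close>; and if \<open>j\<close> is isolated in \<open>J\<close>, then \<open>F\<^sub>j\<close>
  can only be dominated by its own representative. Conversely, given \<open>I\<close>, take one vertex
  of each \<open>F\<^sub>j\<close> with \<open>j \<in> I\<close>, a dominating one if there is any: \<open>F\<^sub>i\<close> is dominated by the representative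
  of a neighbour of \<open>i\<close> in \<open>I\<close>, if there is one, and otherwise by its own representative.
\<close>

section \<open>Domination in finite graphs\<close>

lemma dominates_with_proj [simp]: "v \<rightarrow>\<^bsub>with_proj H\<^esub> u \<longleftrightarrow> (v, u) \<in> parcs H"
  by (simp add: arcs_ends_def arc_to_ends_def)

lemma dominating_set_with_proj:
  "dominating_set (with_proj H) D \<longleftrightarrow>
     D \<subseteq> pverts H \<and> (\<forall>v \<in> pverts H - D. \<exists>u \<in> D. (v, u) \<in> parcs H)"
  by (simp add: dominating_set_def)

lemma isolated_vertex_induce_subgraph:
  "isolated_vertex (with_proj H \<restriction> I) v \<longleftrightarrow> v \<in> I \<and> (\<forall>u \<in> I. (v, u) \<notin> parcs H)"
  by (auto simp: isolated_vertex_def induce_subgraph_def arcs_ends_def arc_to_ends_def)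

lemma finite_dominating_sets:
  "finite (verts H) \<Longrightarrow> finite {D. dominating_set H D}"
  by (rule finite_subset[of _ "Pow (verts H)"]) (auto simp: dominating_set_def)

lemma domination_number_le:
  "finite (verts H) \<Longrightarrow> dominating_set H D \<Longrightarrow> domination_number H \<le> card D"
  unfolding domination_number_def by (rule Min_le) (auto simp: finite_dominating_sets)

text \<open>The full vertex set dominates, so the \<open>Min\<close> in
  \<open>domination_number\<close> ranges over a nonempty finite set and is attained.\<close>

lemma ex_minimum_dominating_set:
  assumes "finite (verts H)"
  shows "\<exists>D. minimum_dominating_set H D"
proof -
  have "dominating_set H (verts H)"
    by (simp add: dominating_set_def)
  then have "domination_number H \<in> card ` {D. dominating_set H D}"
    unfolding domination_number_def using finite_dominating_sets[OF assms]
    by (intro Min_in) auto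
  then show ?thesis
    by (auto simp: minimum_dominating_set_def)
qed

text \<open>A singleton gives the bound 1 from above; the value 0 is excluded because the empty set
  cannot dominate a nonempty graph.\<close>

lemma domination_number_eq_1_iff:
  assumes fin: "finite (verts H)" and ne: "verts H \<noteq> {}"
  shows "domination_number H = 1 \<longleftrightarrow> (\<exists>x. dominating_set H {x})"
proof
  assume "domination_number H = 1"
  then show "\<exists>x. dominating_set H {x}"
    using ex_minimum_dominating_set[OF fin]
    by (metis card_1_singletonE minimum_dominating_set_def)
next
  assume "\<exists>x. dominating_set H {x}"
  then have "domination_number H \<le> 1"
    using domination_number_le[OF fin] by force
  moreover obtain D where D: "dominating_set H D" "card D = domination_number H"
    using ex_minimum_dominating_set[OF fin] by (auto simp: minimum_dominating_set_def)
  have "D \<noteq> {}" "finite D"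
    using D(1) ne fin by (auto simp: dominating_set_def intro: finite_subset)
  then have "domination_number H > 0"
    using D(2) by (metis card_gt_0_iff)
  ultimately show "domination_number H = 1" by simp
qed

section \<open>The product and the projection of its vertex sets to \<open>G\<close>\<close>

locale lex_family =
  fixes G :: "'i pair_pre_digraph" and F :: "'i \<Rightarrow> 'a pair_pre_digraph"
  assumes graph_G: "pair_graph G"
    and graph_F: "\<And>i. i \<in> pverts G \<Longrightarrow> pair_graph (F i)"
    and nonempty_F: "\<And>i. i \<in> pverts G \<Longrightarrow> pverts (F i) \<noteq> {}"
    and disjoint_F: "disjoint_family_on (\<lambda>i. pverts (F i)) (pverts G)"
begin

abbreviation P :: "'a pair_pre_digraph" where
  "P \<equiv> gen_lex_product G F"

text \<open>This is the set \<open>J\<close> of the overview. Indices are restricted to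
  \<open>pverts G\<close> because the total function \<open>F\<close> is unconstrained
  elsewhere.\<close>

definition shadow :: "'a set \<Rightarrow> 'i set" where
  "shadow D = {i \<in> pverts G. D \<inter> pverts (F i) \<noteq> {}}"

lemma finite_G: "finite (pverts G)"
  using graph_G by (simp add: pair_graph_def pair_digraph_def pair_fin_digraph_def
      pair_fin_digraph_axioms_def)

lemma finite_F: "i \<in> pverts G \<Longrightarrow> finite (pverts (F i))"
  using graph_F by (simp add: pair_graph_def pair_digraph_def pair_fin_digraph_def
      pair_fin_digraph_axioms_def)

lemma verts_P: "pverts P = (\<Union>i \<in> pverts G. pverts (F i))"
  by (simp add: gen_lex_product_def)

lemma finite_P: "finite (pverts P)"
  by (simp add: verts_P finite_G finite_F)

lemma same_factor:
  "i \<in> pverts G \<Longrightarrow> j \<in> pverts G \<Longrightarrow> x \<in> pverts (F i) \<Longrightarrow> x \<in> pverts (F j) \<Longrightarrow> i = j"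
  using disjoint_F by (auto simp: disjoint_family_on_def)

lemma inner_arc_iff:
  assumes "i \<in> pverts G" "x \<in> pverts (F i)" "y \<in> pverts (F i)"
  shows "(x, y) \<in> parcs P \<longleftrightarrow> (x, y) \<in> parcs (F i)"
  using gen_lex_product_induced[OF graph_G graph_F disjoint_F assms(1)] assms(2,3)
  by (auto simp: induced_subgraph_def)

lemma cross_arc_iff:
  assumes "i \<in> pverts G" "j \<in> pverts G" "i \<noteq> j" "x \<in> pverts (F i)" "y \<in> pverts (F j)"
  shows "(x, y) \<in> parcs P \<longleftrightarrow> (i, j) \<in> parcs G"
  by (rule gen_lex_product_cross_arc[OF graph_G graph_F disjoint_F assms])

lemma arc_G_neq: "(i, j) \<in> parcs G \<Longrightarrow> i \<noteq> j"
  using graph_G pair_loopfree_digraph.no_loops' by (metis pair_graph_def pair_digraph_def)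

text \<open>An index outside the shadow still owns a vertex of the product, by
  \<open>nonempty_F\<close>. What dominates that vertex lies in another factor, and the index of
  that factor dominates the given one.\<close>

lemma dominating_set_shadow:
  assumes D: "dominating_set (with_proj P) D"
  shows "dominating_set (with_proj G) (shadow D)"
  unfolding dominating_set_with_proj
proof (intro conjI ballI)
  show "shadow D \<subseteq> pverts G"
    by (auto simp: shadow_def)
next
  fix i assume "i \<in> pverts G - shadow D"
  then have i: "i \<in> pverts G" "D \<inter> pverts (F i) = {}"
    by (auto simp: shadow_def)
  then obtain x where x: "x \<in> pverts (F i)"
    using nonempty_F by blast
  then have "x \<in> pverts P - D"
    using i by (auto simp: verts_P)
  then obtain y where y: "y \<in> D" "(x, y) \<in> parcs P"
    using D by (auto simp: dominating_set_with_proj)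
  then obtain j where j: "j \<in> pverts G" "y \<in> pverts (F j)"
    using D by (auto simp: dominating_set_with_proj verts_P)
  \<comment> \<open>\<open>D\<close> misses \<open>F i\<close> but contains \<open>y\<close>, so
    \<open>i\<close> and \<open>j\<close> differ and the arc runs between two factors.\<close>
  have "(i, j) \<in> parcs G"
    using cross_arc_iff[of i j x y] i j x y by blast
  moreover have "j \<in> shadow D"
    using j y by (auto simp: shadow_def)
  ultimately show "\<exists>j \<in> shadow D. (i, j) \<in> parcs G" by blast
qed

lemma finite_shadow: "finite (shadow D)"
  by (simp add: shadow_def finite_G)

lemma card_eq_sum_shadow:
  assumes "D \<subseteq> pverts P"
  shows "card D = (\<Sum>i \<in> shadow D. card (D \<inter> pverts (F i)))"
proof -
  have "D = (\<Union>i \<in> shadow D. D \<inter> pverts (F i))"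
    using assms unfolding shadow_def verts_P by blast
  then have "card D = card (\<Union>i \<in> shadow D. D \<inter> pverts (F i))"
    by simp
  also have "\<dots> = (\<Sum>i \<in> shadow D. card (D \<inter> pverts (F i)))"
    using same_factor by (intro card_UN_disjoint finite_shadow) (auto simp: shadow_def finite_F)
  finally show ?thesis .
qed

lemma card_Int_factor_pos: "i \<in> shadow D \<Longrightarrow> card (D \<inter> pverts (F i)) \<ge> 1"
  by (simp add: shadow_def Suc_le_eq card_gt_0_iff finite_F)

lemma card_shadow_le:
  assumes "D \<subseteq> pverts P"
  shows "card (shadow D) \<le> card D"
  using sum_mono[of "shadow D" "\<lambda>_. 1", OF card_Int_factor_pos]
  by (simp add: card_eq_sum_shadow[OF assms])

text \<open>By \<open>card_eq_sum_shadow\<close>, \<open>card D\<close> is a sum of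
  \<open>card (shadow D)\<close> terms, each at least 1. A single term above 1 would make the sum
  exceed the number of its terms.\<close>

lemma card_Int_factor_le_1:
  assumes D: "D \<subseteq> pverts P" "card (shadow D) = card D" and i: "i \<in> pverts G"
  shows "card (D \<inter> pverts (F i)) \<le> 1"
proof (rule ccontr)
  assume *: "\<not> card (D \<inter> pverts (F i)) \<le> 1"
  then have "D \<inter> pverts (F i) \<noteq> {}"
    by auto
  then have "i \<in> shadow D"
    using i by (simp add: shadow_def)
  then have "(\<Sum>i \<in> shadow D. 1) < (\<Sum>i \<in> shadow D. card (D \<inter> pverts (F i)))"
    using * card_Int_factor_pos
    by (intro sum_strict_mono_ex1 finite_shadow ballI bexI[of _ i]) (simp_all only: not_le)
  then show False
    using D card_eq_sum_shadow by simp
qed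

section \<open>Comparison of the two domination numbers\<close>

theorem domination_number_le_product:
  "domination_number (with_proj G) \<le> domination_number (with_proj P)"
proof -
  obtain D where D: "dominating_set (with_proj P) D" "card D = domination_number (with_proj P)"
    using ex_minimum_dominating_set[of "with_proj P"] finite_P
    by (auto simp: minimum_dominating_set_def)
  have "domination_number (with_proj G) \<le> card (shadow D)"
    by (rule domination_number_le) (simp_all add: finite_G dominating_set_shadow D)
  also have "\<dots> \<le> card D"
    using D(1) by (intro card_shadow_le) (simp add: dominating_set_with_proj)
  finally show ?thesis by (simp add: D)
qed

text \<open>The shadow is squeezed: it dominates \<open>G\<close>, hence has at least
  \<open>domination_number (with_proj G)\<close> elements, and it has at most \<open>card D\<close>,
  which equals that number.\<close>

lemma card_shadow_minimum:
  assumes eq: "domination_number (with_proj G) = domination_number (with_proj P)"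
    and D: "minimum_dominating_set (with_proj P) D"
  shows "card (shadow D) = card D" "minimum_dominating_set (with_proj G) (shadow D)"
proof -
  have dom: "dominating_set (with_proj P) D" "card D = domination_number (with_proj G)"
    using D eq by (auto simp: minimum_dominating_set_def)
  have "domination_number (with_proj G) \<le> card (shadow D)"
    by (rule domination_number_le) (simp_all add: finite_G dominating_set_shadow dom)
  moreover have "card (shadow D) \<le> card D"
    using dom(1) by (intro card_shadow_le) (simp add: dominating_set_with_proj)
  ultimately show "card (shadow D) = card D"
    using dom by simp
  then show "minimum_dominating_set (with_proj G) (shadow D)"
    using dom by (simp add: minimum_dominating_set_def dominating_set_shadow)
qed

theorem minimum_dominating_set_Int_factor:
  assumes "domination_number (with_proj G) = domination_number (with_proj P)"
    and "minimum_dominating_set (with_proj P) D" and "i \<in> pverts G"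
  shows "card (D \<inter> pverts (F i)) \<le> 1"
  using assms card_shadow_minimum(1)
  by (intro card_Int_factor_le_1)
     (auto simp: minimum_dominating_set_def dominating_set_with_proj)

lemma domination_number_isolated_factor:
  assumes D: "dominating_set (with_proj P) D"
    and j: "j \<in> shadow D" and isolated: "\<forall>k \<in> shadow D. (j, k) \<notin> parcs G"
    and le: "card (D \<inter> pverts (F j)) \<le> 1"
  shows "domination_number (with_proj (F j)) = 1"
proof -
  have jG: "j \<in> pverts G"
    using j by (simp add: shadow_def)
  have "card (D \<inter> pverts (F j)) = 1"
    using le card_Int_factor_pos[OF j] by simp
  then obtain x where x: "D \<inter> pverts (F j) = {x}"
    by (auto simp: card_1_singleton_iff)
  have "(y, x) \<in> parcs (F j)" if y: "y \<in> pverts (F j)" "y \<noteq> x" for y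
  proof -
    have "y \<in> pverts P - D"
      using y x jG by (auto simp: verts_P)
    then obtain z where z: "z \<in> D" "(y, z) \<in> parcs P"
      using D by (auto simp: dominating_set_with_proj)
    then obtain k where k: "k \<in> pverts G" "z \<in> pverts (F k)"
      using D by (auto simp: dominating_set_with_proj verts_P)
    then have "k \<in> shadow D"
      using z by (auto simp: shadow_def)
    \<comment> \<open>Otherwise the arc from \<open>y\<close> to \<open>z\<close> would project to
      an arc from \<open>j\<close> to \<open>k\<close> inside the shadow, against isolation.\<close>
    then have "k = j"
      using isolated cross_arc_iff[of j k y z] jG k y z by blast
    then have "z = x"
      using k z x by blast
    then show ?thesis
      using inner_arc_iff[OF jG y(1)] z k \<open>k = j\<close> by blast
  qed
  then have "dominating_set (with_proj (F j)) {x}"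
    using x by (auto simp: dominating_set_with_proj)
  then show ?thesis
    using domination_number_eq_1_iff[of "with_proj (F j)"] finite_F[OF jG] nonempty_F[OF jG]
    by auto
qed

text \<open>This bounds the domination number of the product by \<open>card I\<close>; the opposite
  bound is \<open>domination_number_le_product\<close>.\<close>

lemma ex_dominating_transversal:
  assumes I: "dominating_set (with_proj G) I"
    and isolated: "\<And>j. j \<in> I \<Longrightarrow> \<forall>k \<in> I. (j, k) \<notin> parcs G \<Longrightarrow>
      domination_number (with_proj (F j)) = 1"
  shows "\<exists>D. dominating_set (with_proj P) D \<and> card D \<le> card I"
proof -
  have IG: "I \<subseteq> pverts G"
    using I by (simp add: dominating_set_with_proj)
  \<comment> \<open>With the implication under the quantifier, one choice function \<open>r\<close>
    serves both kinds of factors: its value is a dominating vertex if one exists, and an arbitrary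
    vertex otherwise.\<close>
  have "\<exists>x \<in> pverts (F j). domination_number (with_proj (F j)) = 1 \<longrightarrow>
      dominating_set (with_proj (F j)) {x}" if "j \<in> I" for j
    using that IG domination_number_eq_1_iff[of "with_proj (F j)"] finite_F[of j] nonempty_F[of j]
    by (fastforce simp: dominating_set_with_proj)
  then obtain r where r: "\<And>j. j \<in> I \<Longrightarrow> r j \<in> pverts (F j)"
    and r_dom: "\<And>j. j \<in> I \<Longrightarrow> domination_number (with_proj (F j)) = 1 \<Longrightarrow>
      dominating_set (with_proj (F j)) {r j}"
    by metis
  have via: "\<exists>u \<in> r ` I. (v, u) \<in> parcs P"
    if "i \<in> pverts G" "v \<in> pverts (F i)" "k \<in> I" "(i, k) \<in> parcs G" for i k v
    using cross_arc_iff[of i k v "r k"] arc_G_neq r IG that by blast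
  have "\<exists>u \<in> r ` I. (v, u) \<in> parcs P" if v: "v \<in> pverts P - r ` I" for v
  proof -
    obtain i where i: "i \<in> pverts G" "v \<in> pverts (F i)"
      using v by (auto simp: verts_P)
    show ?thesis
    proof (cases "\<exists>k \<in> I. (i, k) \<in> parcs G")
      case True
      then show ?thesis using via i by blast
    next
      case False
      \<comment> \<open>Without a neighbour in \<open>I\<close>, the index \<open>i\<close> must
        itself belong to \<open>I\<close> and is isolated there, so the hypothesis makes
        \<open>r i\<close> dominate all of \<open>F i\<close>.\<close>
      then have iI: "i \<in> I"
        using I i by (auto simp: dominating_set_with_proj)
      then have "dominating_set (with_proj (F i)) {r i}"
        using False isolated r_dom by blast
      then have "(v, r i) \<in> parcs (F i)"
        using v i iI by (auto simp: dominating_set_with_proj)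
      then show ?thesis
        using inner_arc_iff[OF i r[OF iI]] iI by blast
    qed
  qed
  moreover have "r ` I \<subseteq> pverts P"
    using r IG by (auto simp: verts_P)
  ultimately have "dominating_set (with_proj P) (r ` I)"
    by (simp add: dominating_set_with_proj)
  moreover have "card (r ` I) \<le> card I"
    using IG finite_G by (intro card_image_le) (rule finite_subset)
  ultimately show ?thesis by blast
qed

theorem domination_number_eq_product_iff:
  "domination_number (with_proj G) = domination_number (with_proj P) \<longleftrightarrow>
     (\<exists>I. minimum_dominating_set (with_proj G) I \<and>
       (\<forall>j\<in>I. isolated_vertex (with_proj G \<restriction> I) j \<longrightarrow>
          domination_number (with_proj (F j)) = 1))" (is "?eq \<longleftrightarrow> ?ex")
proof
  assume eq: ?eq
  obtain D where D: "minimum_dominating_set (with_proj P) D"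
    using ex_minimum_dominating_set[of "with_proj P"] finite_P by auto
  then have dom: "dominating_set (with_proj P) D"
    by (simp add: minimum_dominating_set_def)
  \<comment> \<open>The witness for \<open>I\<close> is the shadow of a minimum dominating set of
    the product; by minimality that set has only one vertex in each factor it meets.\<close>
  have "domination_number (with_proj (F j)) = 1"
    if "j \<in> shadow D" "isolated_vertex (with_proj G \<restriction> shadow D) j" for j
    using domination_number_isolated_factor[OF dom that(1)] that
      minimum_dominating_set_Int_factor[OF eq D, of j]
    by (simp add: isolated_vertex_induce_subgraph shadow_def)
  then show ?ex
    using card_shadow_minimum(2)[OF eq D] by blast
next
  assume ?ex
  then obtain I where I: "dominating_set (with_proj G) I"
      "card I = domination_number (with_proj G)"
    and isolated: "\<And>j. j \<in> I \<Longrightarrow> \<forall>k \<in> I. (j, k) \<notin> parcs G \<Longrightarrow>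
      domination_number (with_proj (F j)) = 1"
    by (auto simp: minimum_dominating_set_def isolated_vertex_induce_subgraph)
  obtain D where D: "dominating_set (with_proj P) D" "card D \<le> card I"
    using ex_dominating_transversal[OF I(1) isolated] by blast
  have "domination_number (with_proj P) \<le> card D"
    by (rule domination_number_le) (simp_all add: finite_P D)
  then show ?eq
    using D I domination_number_le_product by simp
qed

end

theorem theorem2p2:
  fixes n :: nat
    and G :: "nat pair_pre_digraph"
    and F :: "nat \<Rightarrow> 'a pair_pre_digraph"
  assumes "n \<ge> 2"
    and "pair_graph G"
    and "pverts G = {1..n}"
    and "Digraph_Component.connected (with_proj G)"
    and "\<And>i. i \<in> {1..n} \<Longrightarrow> pair_graph (F i)"
    and "\<And>i. i \<in> {1..n} \<Longrightarrow> pverts (F i) \<noteq> {}"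
    and "disjoint_family_on (\<lambda>i. pverts (F i)) {1..n}"
  shows "domination_number (with_proj G) \<le> domination_number (with_proj (gen_lex_product G F))
    \<and> (domination_number (with_proj G) = domination_number (with_proj (gen_lex_product G F)) \<longleftrightarrow>
        (\<exists>I. minimum_dominating_set (with_proj G) I \<and>
             (\<forall>j\<in>I. isolated_vertex (with_proj G \<restriction> I) j \<longrightarrow>
                domination_number (with_proj (F j)) = 1)))
    \<and> (domination_number (with_proj G) = domination_number (with_proj (gen_lex_product G F)) \<longrightarrow>
        (\<forall>D. minimum_dominating_set (with_proj (gen_lex_product G F)) D \<longrightarrow>
             (\<forall>i\<in>{1..n}. card (D \<inter> pverts (F i)) \<le> 1)))"
proof -
  interpret lex_family G F
    using assms(2,3,5-7) by (simp add: lex_family_def)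
  show ?thesis
    using domination_number_le_product domination_number_eq_product_iff
      minimum_dominating_set_Int_factor assms(3)
    by simp
qed

end
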